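(* Let $G$ be a locally compact group. (i) Let $F=(F^0,F^1,s,r)$ be a topological graph, let $q:P\to F^0$ be a principal $G$-bundle, and let $\theta:s^*(P)\to r^*(P)$ be an isomorphism of principal $G$-bundles over $F^1$. Put $E^0:=P$, $E^1:=s^*(P)$, $\tilde s(e,v):=v$ for $(e,v)\in s^*(P)$, and $\tilde r:=\pi_2\circ\theta$, where $\pi_2:r^*(P)\to P$ is $\pi_2(e,v)=v$. Then $(E^0,E^1,\tilde s,\tilde r)$ is a topological graph and $G$ acts freely and properly on it (via the given action on $P$ and the action $g\cdot(e,v)=(e,g\cdot v)$ on $s^*(P)$). (ii) Conversely, every topological graph $(E^0,E^1,\tilde s,\tilde r)$ on which $G$ acts freely and properly is isomorphic to one arising as in (i) from some $F$, $P$, $q$, $\theta$.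
   Context: A topological graph $E=(E^0,E^1,s,r)$ consists of locally compact Hausdorff spaces $E^0,E^1$ and continuous maps $s,r:E^1\to E^0$ with $s$ a local homeomorphism. An isomorphism of topological graphs is a pair of homeomorphisms (on vertices and on edges) commuting with the source and range maps. A locally compact group $G$ acts on $E$ if there are continuous maps $G\times E^i\to E^i$, $(g,x)\mapsto g\cdot x$ ($i=0,1$), such that $g\mapsto(\text{the pair of maps }x\mapsto g\cdot x)$ is a group homomorphism from $G$ to the automorphism group of $E$. The action is free if $g\cdot v=v$ for some $v\in E^0$ implies $g=1_G$; it is proper if the maps $G\times E^i\to E^i\times E^i$, $(g,x)\mapsto(g\cdot x,x)$ are proper for $i=0,1$. A map $q:P\to X$ of locally compact Hausdorff spaces is a principal $G$-bundle if there is a free and proper action of $G$ on $P$ and $q$ induces an identification of $P/G$ with $X$ (no local triviality is assumed). For continuous $f:Y\to X$, the pull-back is the principal $G$-bundle $f^*(P)=\{(y,p)\in Y\times P: f(y)=q(p)\}$ over $Y$, with bundle map $\pi_1(y,p)=y$ and action $g\cdot(y,p)=(y,g\cdot p)$. An isomorphism of principal $G$-bundles over the same base is a $G$-equivariant homeomorphism commuting with the bundle maps. *)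

theory Defs
  imports "HOL-Analysis.Analysis" "HOL-Algebra.Group_Action"
begin

text \<open>
  Spaces are abstract topologies, since the base graph in the converse direction lives on orbit
  sets and pull-backs are subspaces. Maps are HOL functions of which only the values on the
  relevant carriers matter. A topological group is a group \<open>G\<close> together with a topology \<open>T\<close> on
  its carrier.
\<close>

section \<open>Topological graphs\<close>

definition local_homeomorphism :: "'a topology \<Rightarrow> 'b topology \<Rightarrow> ('a \<Rightarrow> 'b) \<Rightarrow> bool" where
  "local_homeomorphism X Y f \<longleftrightarrow>
     continuous_map X Y f \<and>
     (\<forall>x \<in> topspace X. \<exists>U. openin X U \<and> x \<in> U \<and> openin Y (f ` U) \<and>
        homeomorphic_map (subtopology X U) (subtopology Y (f ` U)) f)"

record ('v, 'e) tgraph =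
  verts :: "'v topology"
  edges :: "'e topology"
  src :: "'e \<Rightarrow> 'v"
  rng :: "'e \<Rightarrow> 'v"

definition topological_graph :: "('v, 'e) tgraph \<Rightarrow> bool" where
  "topological_graph E \<longleftrightarrow>
     locally_compact_space (verts E) \<and> Hausdorff_space (verts E) \<and>
     locally_compact_space (edges E) \<and> Hausdorff_space (edges E) \<and>
     local_homeomorphism (edges E) (verts E) (src E) \<and>
     continuous_map (edges E) (verts E) (rng E)"

definition tgraph_iso ::
  "('v, 'e) tgraph \<Rightarrow> ('w, 'f) tgraph \<Rightarrow> ('v \<Rightarrow> 'w) \<Rightarrow> ('e \<Rightarrow> 'f) \<Rightarrow> bool" where
  "tgraph_iso E F \<phi>0 \<phi>1 \<longleftrightarrow>
     homeomorphic_map (verts E) (verts F) \<phi>0 \<and>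
     homeomorphic_map (edges E) (edges F) \<phi>1 \<and>
     (\<forall>e \<in> topspace (edges E).
        src F (\<phi>1 e) = \<phi>0 (src E e) \<and> rng F (\<phi>1 e) = \<phi>0 (rng E e))"

section \<open>Actions of locally compact groups\<close>

text \<open>
  The Hausdorff axiom for groups, often part of the convention, is not required here. A group
  acting freely and continuously on a nonempty Hausdorff space is Hausdorff anyway.
\<close>

definition locally_compact_group :: "('g, 'm) monoid_scheme \<Rightarrow> 'g topology \<Rightarrow> bool" where
  "locally_compact_group G T \<longleftrightarrow>
     group G \<and> topspace T = carrier G \<and>
     continuous_map (prod_topology T T) T (\<lambda>(g, h). g \<otimes>\<^bsub>G\<^esub> h) \<and>
     continuous_map T T (\<lambda>g. inv\<^bsub>G\<^esub> g) \<and>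
     locally_compact_space T"

text \<open>
  The library locale \<open>group_action\<close> asks for extensional functions, hence the restriction;
  \<open>a\<close> itself is arbitrary outside the space it acts on.
\<close>

definition continuous_action ::
  "('g, 'm) monoid_scheme \<Rightarrow> 'g topology \<Rightarrow> 'x topology \<Rightarrow> ('g \<Rightarrow> 'x \<Rightarrow> 'x) \<Rightarrow> bool" where
  "continuous_action G T X a \<longleftrightarrow>
     group_action G (topspace X) (\<lambda>g. restrict (a g) (topspace X)) \<and>
     continuous_map (prod_topology T X) X (\<lambda>(g, x). a g x)"

definition free_action ::
  "('g, 'm) monoid_scheme \<Rightarrow> 'x topology \<Rightarrow> ('g \<Rightarrow> 'x \<Rightarrow> 'x) \<Rightarrow> bool" where
  "free_action G X a \<longleftrightarrow>
     (\<forall>g \<in> carrier G. \<forall>x \<in> topspace X. a g x = x \<longrightarrow> g = \<one>\<^bsub>G\<^esub>)"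

definition proper_action :: "'g topology \<Rightarrow> 'x topology \<Rightarrow> ('g \<Rightarrow> 'x \<Rightarrow> 'x) \<Rightarrow> bool" where
  "proper_action T X a \<longleftrightarrow>
     proper_map (prod_topology T X) (prod_topology X X) (\<lambda>(g, x). (a g x, x))"

text \<open>
  The two \<open>continuous_action\<close> conjuncts contain the homomorphism property of
  \<open>g \<mapsto> (a0 g, a1 g)\<close>; the last conjunct puts its values among the automorphisms of \<open>E\<close>.
\<close>

definition tgraph_action ::
  "('g, 'm) monoid_scheme \<Rightarrow> 'g topology \<Rightarrow> ('v, 'e) tgraph \<Rightarrow>
   ('g \<Rightarrow> 'v \<Rightarrow> 'v) \<Rightarrow> ('g \<Rightarrow> 'e \<Rightarrow> 'e) \<Rightarrow> bool" where
  "tgraph_action G T E a0 a1 \<longleftrightarrow>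
     continuous_action G T (verts E) a0 \<and>
     continuous_action G T (edges E) a1 \<and>
     (\<forall>g \<in> carrier G. tgraph_iso E E (a0 g) (a1 g))"

definition free_tgraph_action ::
  "('g, 'm) monoid_scheme \<Rightarrow> ('v, 'e) tgraph \<Rightarrow> ('g \<Rightarrow> 'v \<Rightarrow> 'v) \<Rightarrow> bool" where
  "free_tgraph_action G E a0 \<longleftrightarrow> free_action G (verts E) a0"

definition proper_tgraph_action ::
  "'g topology \<Rightarrow> ('v, 'e) tgraph \<Rightarrow> ('g \<Rightarrow> 'v \<Rightarrow> 'v) \<Rightarrow> ('g \<Rightarrow> 'e \<Rightarrow> 'e) \<Rightarrow> bool" where
  "proper_tgraph_action T E a0 a1 \<longleftrightarrow>
     proper_action T (verts E) a0 \<and> proper_action T (edges E) a1"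

section \<open>Principal bundles\<close>

definition orbit_space ::
  "('g, 'm) monoid_scheme \<Rightarrow> 'p topology \<Rightarrow> ('g \<Rightarrow> 'p \<Rightarrow> 'p) \<Rightarrow> 'p set topology" where
  "orbit_space G P a =
     topology (\<lambda>U. U \<subseteq> orbits G (topspace P) a \<and> openin P {p \<in> topspace P. orbit G a p \<in> U})"

lemma openin_orbit_space:
  "openin (orbit_space G P a) U \<longleftrightarrow>
     U \<subseteq> orbits G (topspace P) a \<and> openin P {p \<in> topspace P. orbit G a p \<in> U}"
proof -
  let ?L = "\<lambda>U. U \<subseteq> orbits G (topspace P) a \<and> openin P {p \<in> topspace P. orbit G a p \<in> U}"
  have "istopology ?L"
    unfolding istopology_def
  proof (rule conjI; intro allI impI)
    fix S T assume "?L S" "?L T"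
    moreover have "{p \<in> topspace P. orbit G a p \<in> S \<inter> T} =
        {p \<in> topspace P. orbit G a p \<in> S} \<inter> {p \<in> topspace P. orbit G a p \<in> T}"
      by auto
    ultimately show "?L (S \<inter> T)" by (auto simp only: openin_Int)
  next
    fix K assume K: "\<forall>S\<in>K. ?L S"
    have "{p \<in> topspace P. orbit G a p \<in> \<Union>K} =
        (\<Union>S\<in>K. {p \<in> topspace P. orbit G a p \<in> S})"
      by auto
    moreover have "openin P (\<Union>S\<in>K. {p \<in> topspace P. orbit G a p \<in> S})"
      using K by (intro openin_Union) auto
    ultimately show "?L (\<Union>K)" using K by auto
  qed
  then show ?thesis
    by (simp add: orbit_space_def)
qed

definition principal_bundle ::
  "('g, 'm) monoid_scheme \<Rightarrow> 'g topology \<Rightarrow> 'p topology \<Rightarrow> ('g \<Rightarrow> 'p \<Rightarrow> 'p) \<Rightarrow>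
   'x topology \<Rightarrow> ('p \<Rightarrow> 'x) \<Rightarrow> bool" where
  "principal_bundle G T P a X q \<longleftrightarrow>
     locally_compact_space P \<and> Hausdorff_space P \<and>
     locally_compact_space X \<and> Hausdorff_space X \<and>
     continuous_action G T P a \<and> free_action G P a \<and> proper_action T P a \<and>
     (\<exists>h. homeomorphic_map (orbit_space G P a) X h \<and>
          (\<forall>p \<in> topspace P. h (orbit G a p) = q p))"

definition pullback_space ::
  "'y topology \<Rightarrow> ('y \<Rightarrow> 'x) \<Rightarrow> 'p topology \<Rightarrow> ('p \<Rightarrow> 'x) \<Rightarrow> ('y \<times> 'p) topology" where
  "pullback_space Y f P q =
     subtopology (prod_topology Y P) {(y, p). y \<in> topspace Y \<and> p \<in> topspace P \<and> f y = q p}"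

definition pullback_act :: "('g \<Rightarrow> 'p \<Rightarrow> 'p) \<Rightarrow> 'g \<Rightarrow> 'y \<times> 'p \<Rightarrow> 'y \<times> 'p" where
  "pullback_act a g = (\<lambda>(y, p). (y, a g p))"

text \<open>
  The two bundles \<open>(P, a, q)\<close> and \<open>(P', a', q')\<close> have the same base.
\<close>

definition bundle_iso ::
  "('g, 'm) monoid_scheme \<Rightarrow>
   'p topology \<Rightarrow> ('g \<Rightarrow> 'p \<Rightarrow> 'p) \<Rightarrow> ('p \<Rightarrow> 'x) \<Rightarrow>
   'r topology \<Rightarrow> ('g \<Rightarrow> 'r \<Rightarrow> 'r) \<Rightarrow> ('r \<Rightarrow> 'x) \<Rightarrow> ('p \<Rightarrow> 'r) \<Rightarrow> bool" where
  "bundle_iso G P a q P' a' q' \<theta> \<longleftrightarrow>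
     homeomorphic_map P P' \<theta> \<and>
     (\<forall>g \<in> carrier G. \<forall>p \<in> topspace P. \<theta> (a g p) = a' g (\<theta> p)) \<and>
     (\<forall>p \<in> topspace P. q' (\<theta> p) = q p)"

definition bundle_data ::
  "('g, 'm) monoid_scheme \<Rightarrow> 'g topology \<Rightarrow> ('v, 'e) tgraph \<Rightarrow> 'p topology \<Rightarrow>
   ('g \<Rightarrow> 'p \<Rightarrow> 'p) \<Rightarrow> ('p \<Rightarrow> 'v) \<Rightarrow> ('e \<times> 'p \<Rightarrow> 'e \<times> 'p) \<Rightarrow> bool" where
  "bundle_data G T F P a q \<theta> \<longleftrightarrow>
     topological_graph F \<and>
     principal_bundle G T P a (verts F) q \<and>
     bundle_iso G
       (pullback_space (edges F) (src F) P q) (pullback_act a) fst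
       (pullback_space (edges F) (rng F) P q) (pullback_act a) fst \<theta>"

definition bundle_graph ::
  "('v, 'e) tgraph \<Rightarrow> 'p topology \<Rightarrow> ('p \<Rightarrow> 'v) \<Rightarrow> ('e \<times> 'p \<Rightarrow> 'e \<times> 'p) \<Rightarrow>
   ('p, 'e \<times> 'p) tgraph" where
  "bundle_graph F P q \<theta> =
     \<lparr>verts = P, edges = pullback_space (edges F) (src F) P q, src = snd, rng = snd \<circ> \<theta>\<rparr>"

end

theory Submission
  imports Defs
begin

text \<open>
  For (i), the source map of the new graph is a base change of the local homeomorphism \<open>s\<close>, and
  properness of the action passes from \<open>P\<close> to \<open>s\<^sup>*(P)\<close> along the equivariant map \<open>\<pi>\<^sub>2\<close>, by
  the compact preimage criterion. For (ii), \<open>F\<close> is the graph of orbits. An equivariant map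
  \<open>f : X \<rightarrow> Y\<close> into a free and proper action induces a homeomorphism
  \<open>x \<mapsto> (G x, f x)\<close> of \<open>X\<close> onto the pull-back of \<open>Y \<rightarrow> Y/G\<close> along \<open>X/G \<rightarrow> Y/G\<close>. Taking
  \<open>f\<close> to be the source and the range map of \<open>E\<close> yields two homeomorphisms
  \<open>\<phi> : E\<^sup>1 \<rightarrow> s\<^sup>*(E\<^sup>0)\<close> and \<open>\<psi> : E\<^sup>1 \<rightarrow> r\<^sup>*(E\<^sup>0)\<close>, and \<open>\<theta> = \<psi> \<circ> \<phi>\<^sup>-\<^sup>1\<close>. The source
  map of \<open>F\<close> is a local homeomorphism because its base change along the open surjection
  \<open>E\<^sup>0 \<rightarrow> E\<^sup>0/G\<close> is one.
\<close>

section \<open>Local homeomorphisms and pull-backs\<close>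

text \<open>Splits the notion into openness and local injectivity, which can then be followed
  separately through base change and descent. An open set is a union of pieces mapped
  homeomorphically onto open sets; conversely a continuous open map is a homeomorphism onto its
  image wherever it is injective.\<close>

lemma local_homeomorphism_iff:
  "local_homeomorphism X Y f \<longleftrightarrow>
     continuous_map X Y f \<and> open_map X Y f \<and>
     (\<forall>x \<in> topspace X. \<exists>U. openin X U \<and> x \<in> U \<and> inj_on f U)"
  (is "?L \<longleftrightarrow> ?R")
proof
  assume L: ?L
  have "openin Y (f ` W)" if W: "openin X W" for W
  proof (subst openin_subopen, intro ballI)
    fix y assume "y \<in> f ` W"
    then obtain x where x: "x \<in> W" "y = f x" by auto
    then have "x \<in> topspace X" using W openin_subset by blast
    with L obtain U where U: "openin X U" "x \<in> U" "openin Y (f ` U)"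
      "homeomorphic_map (subtopology X U) (subtopology Y (f ` U)) f"
      unfolding local_homeomorphism_def by blast
    have "openin (subtopology X U) (U \<inter> W)"
      using W openin_subtopology_Int2 by blast
    then have "openin (subtopology Y (f ` U)) (f ` (U \<inter> W))"
      using homeomorphic_imp_open_map[OF U(4)] by (simp add: open_map_def)
    then have "openin Y (f ` (U \<inter> W))"
      using U(3) openin_trans_full by blast
    then show "\<exists>V. openin Y V \<and> y \<in> V \<and> V \<subseteq> f ` W"
      using x U(2) by (intro exI[of _ "f ` (U \<inter> W)"]) auto
  qed
  moreover have "\<exists>U. openin X U \<and> x \<in> U \<and> inj_on f U" if "x \<in> topspace X" for x
  proof -
    from L that obtain U where U: "openin X U" "x \<in> U"
      "homeomorphic_map (subtopology X U) (subtopology Y (f ` U)) f"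
      unfolding local_homeomorphism_def by blast
    then have "inj_on f U"
      using homeomorphic_imp_injective_map[OF U(3)] topspace_subtopology_subset[OF openin_subset[OF U(1)]]
      by simp
    with U show ?thesis by blast
  qed
  ultimately show ?R
    using L unfolding local_homeomorphism_def open_map_def by blast
next
  assume R: ?R
  show ?L
    unfolding local_homeomorphism_def
  proof (intro conjI ballI)
    show "continuous_map X Y f" using R by blast
    fix x assume "x \<in> topspace X"
    with R obtain U where U: "openin X U" "x \<in> U" "inj_on f U" by blast
    have op: "openin Y (f ` U)" using R U(1) by (simp add: open_map_def)
    have "homeomorphic_map (subtopology X U) (subtopology Y (f ` U)) f"
    proof (rule bijective_open_imp_homeomorphic_map)
      show "continuous_map (subtopology X U) (subtopology Y (f ` U)) f"
        using R by (intro continuous_map_into_subtopology continuous_map_from_subtopology) auto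
      show "open_map (subtopology X U) (subtopology Y (f ` U)) f"
        unfolding open_map_def
      proof (intro allI impI)
        fix V assume "openin (subtopology X U) V"
        then have "openin X V" "V \<subseteq> U"
          using U(1) by (auto simp: openin_open_subtopology)
        then show "openin (subtopology Y (f ` U)) (f ` V)"
          using R op by (auto simp: openin_open_subtopology open_map_def)
      qed
      have "U \<subseteq> topspace X" "f ` U \<subseteq> topspace Y" using U(1) op openin_subset by auto
      then show "f ` topspace (subtopology X U) = topspace (subtopology Y (f ` U))"
        and "inj_on f (topspace (subtopology X U))"
        using U(3) by (auto simp: Int_absorb1)
    qed
    with U op show "\<exists>U. openin X U \<and> x \<in> U \<and> openin Y (f ` U) \<and>
        homeomorphic_map (subtopology X U) (subtopology Y (f ` U)) f" by blast
  qed
qed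

text \<open>Used to recognise the projection \<open>snd\<close> from a pull-back as a local
  homeomorphism once the pull-back is identified with a space of edges. Agreement of
  \<open>g\<close> with the composite on the carrier is enough there.\<close>

lemma local_homeomorphism_compose_homeomorphic_map:
  assumes \<phi>: "homeomorphic_map X Y \<phi>" and f: "local_homeomorphism Y Z f"
    and eq: "\<And>x. x \<in> topspace X \<Longrightarrow> g x = f (\<phi> x)"
  shows "local_homeomorphism X Z g"
  unfolding local_homeomorphism_iff
proof (intro conjI ballI)
  have f': "continuous_map Y Z f" "open_map Y Z f"
    using f by (auto simp: local_homeomorphism_iff)
  show "continuous_map X Z g"
    using continuous_map_compose[OF homeomorphic_imp_continuous_map[OF \<phi>] f'(1)] eq
    by (auto elim: continuous_map_eq)
  show "open_map X Z g"
    unfolding open_map_def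
  proof (intro allI impI)
    fix U assume U: "openin X U"
    then have "openin Z (f ` \<phi> ` U)"
      using homeomorphic_imp_open_map[OF \<phi>] f'(2) by (simp add: open_map_def)
    moreover have "g ` U = f ` \<phi> ` U"
      unfolding image_image using openin_subset[OF U] eq by (intro image_cong) auto
    ultimately show "openin Z (g ` U)" by simp
  qed
  fix x assume x: "x \<in> topspace X"
  then have "\<phi> x \<in> topspace Y" using homeomorphic_imp_surjective_map[OF \<phi>] by blast
  then obtain U where U: "openin Y U" "\<phi> x \<in> U" "inj_on f U"
    using f unfolding local_homeomorphism_iff by blast
  have "openin X {x \<in> topspace X. \<phi> x \<in> U}"
    by (rule openin_continuous_map_preimage[OF homeomorphic_imp_continuous_map[OF \<phi>] U(1)])
  moreover have "inj_on g {x \<in> topspace X. \<phi> x \<in> U}"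
    using U(3) homeomorphic_imp_injective_map[OF \<phi>] eq by (auto simp: inj_on_def)
  ultimately show "\<exists>V. openin X V \<and> x \<in> V \<and> inj_on g V"
    using x U(2) by blast
qed

lemma openin_prod_topology_imp_box:
  assumes "openin (prod_topology X Y) S" "(x, y) \<in> S"
  obtains U V where "openin X U" "openin Y V" "x \<in> U" "y \<in> V" "U \<times> V \<subseteq> S"
proof -
  have "\<exists>U V. openin X U \<and> openin Y V \<and> x \<in> U \<and> y \<in> V \<and> U \<times> V \<subseteq> S"
    by (rule openin_prod_topology_alt[THEN iffD1, rule_format]) (fact assms)+
  then show thesis using that by (elim exE conjE)
qed

section \<open>The topology of pull-backs and base change\<close>

lemma topspace_pullback_space:
  "topspace (pullback_space Y f P q) = {(y, p). y \<in> topspace Y \<and> p \<in> topspace P \<and> f y = q p}"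
  by (auto simp: pullback_space_def)

lemma continuous_map_pullback_fst: "continuous_map (pullback_space Y f P q) Y fst"
  unfolding pullback_space_def by (intro continuous_map_from_subtopology continuous_map_fst)

lemma continuous_map_pullback_snd: "continuous_map (pullback_space Y f P q) P snd"
  unfolding pullback_space_def by (intro continuous_map_from_subtopology continuous_map_snd)

lemma continuous_map_into_pullback_space:
  assumes "continuous_map Z Y u" "continuous_map Z P v"
    and "\<And>z. z \<in> topspace Z \<Longrightarrow> f (u z) = q (v z)"
  shows "continuous_map Z (pullback_space Y f P q) (\<lambda>z. (u z, v z))"
  unfolding pullback_space_def
  using assms continuous_map_image_subset_topspace[OF assms(1)]
    continuous_map_image_subset_topspace[OF assms(2)]
  by (intro continuous_map_into_subtopology continuous_map_pairedI) auto

lemma openin_pullback_space_imp_box: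
  assumes "openin (pullback_space Y f P q) W" "(y, p) \<in> W"
  obtains A B where "openin Y A" "openin P B" "y \<in> A" "p \<in> B"
    "\<forall>y' \<in> A. \<forall>p' \<in> B. f y' = q p' \<longrightarrow> (y', p') \<in> W"
proof -
  from assms(1) obtain W' where W': "openin (prod_topology Y P) W'"
    "W = W' \<inter> {(y, p). y \<in> topspace Y \<and> p \<in> topspace P \<and> f y = q p}"
    unfolding pullback_space_def openin_subtopology by blast
  with assms(2) have "(y, p) \<in> W'" by simp
  with W'(1) obtain A B where AB: "openin Y A" "openin P B" "y \<in> A" "p \<in> B" "A \<times> B \<subseteq> W'"
    by (rule openin_prod_topology_imp_box)
  show thesis
  proof (rule that[OF AB(1-4)], intro ballI impI)
    fix y' p' assume "y' \<in> A" "p' \<in> B" "f y' = q p'"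
    then show "(y', p') \<in> W"
      using AB(5) openin_subset[OF AB(1)] openin_subset[OF AB(2)] W'(2) by auto
  qed
qed

lemma openin_pullback_space_box:
  assumes "openin Y A" "openin P B"
  shows "openin (pullback_space Y f P q) {(y, p). y \<in> A \<and> p \<in> B \<and> f y = q p}"
proof -
  have "openin (pullback_space Y f P q)
      ({(y, p). y \<in> topspace Y \<and> p \<in> topspace P \<and> f y = q p} \<inter> A \<times> B)"
    unfolding pullback_space_def
    using assms by (simp add: openin_subtopology_Int2 openin_prod_Times_iff)
  moreover have "{(y, p). y \<in> topspace Y \<and> p \<in> topspace P \<and> f y = q p} \<inter> A \<times> B =
      {(y, p). y \<in> A \<and> p \<in> B \<and> f y = q p}"
    using openin_subset[OF assms(1)] openin_subset[OF assms(2)] by auto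
  ultimately show ?thesis by simp
qed

text \<open>The pull-back is the equaliser of two continuous maps into a Hausdorff space, hence a
  closed subspace of the product.\<close>

lemma
  assumes f: "continuous_map Y Z f" and q: "continuous_map P Z q" and Z: "Hausdorff_space Z"
    and Y: "locally_compact_space Y" "Hausdorff_space Y"
    and P: "locally_compact_space P" "Hausdorff_space P"
  shows locally_compact_space_pullback_space: "locally_compact_space (pullback_space Y f P q)"
    and Hausdorff_space_pullback_space: "Hausdorff_space (pullback_space Y f P q)"
proof -
  have "closedin (prod_topology Y P)
      {z \<in> topspace (prod_topology Y P). (f \<circ> fst) z = (q \<circ> snd) z}"
    by (intro closedin_continuous_maps_eq[OF Z] continuous_map_compose[OF _ f]
        continuous_map_compose[OF _ q] continuous_map_fst continuous_map_snd)
  moreover have "{z \<in> topspace (prod_topology Y P). (f \<circ> fst) z = (q \<circ> snd) z} =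
      {(y, p). y \<in> topspace Y \<and> p \<in> topspace P \<and> f y = q p}"
    by auto
  ultimately show "locally_compact_space (pullback_space Y f P q)"
    unfolding pullback_space_def using Y P
    by (intro locally_compact_space_closed_subset) (auto simp: locally_compact_space_prod_topology)
  show "Hausdorff_space (pullback_space Y f P q)"
    unfolding pullback_space_def using Y P
    by (intro Hausdorff_space_subtopology) (auto simp: Hausdorff_space_prod_topology)
qed

lemma local_homeomorphism_pullback_snd:
  assumes f: "local_homeomorphism Y Z f" and q: "continuous_map P Z q"
  shows "local_homeomorphism (pullback_space Y f P q) P snd"
  unfolding local_homeomorphism_iff
proof (intro conjI ballI)
  let ?B = "pullback_space Y f P q"
  show "continuous_map ?B P snd" by (rule continuous_map_pullback_snd)
  show "open_map ?B P snd"
    unfolding open_map_def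
  proof (intro allI impI)
    fix W assume W: "openin ?B W"
    show "openin P (snd ` W)"
    proof (subst openin_subopen, intro ballI)
      fix p assume "p \<in> snd ` W"
      then obtain y where y: "(y, p) \<in> W" by auto
      then obtain A B where AB: "openin Y A" "openin P B" "y \<in> A" "p \<in> B"
        "\<forall>y' \<in> A. \<forall>p' \<in> B. f y' = q p' \<longrightarrow> (y', p') \<in> W"
        by (rule openin_pullback_space_imp_box[OF W])
      have "openin Z (f ` A)"
        using f AB(1) by (simp add: local_homeomorphism_iff open_map_def)
      then have "openin P {p \<in> B. q p \<in> f ` A}"
        using openin_continuous_map_preimage_gen[OF q AB(2)] by blast
      moreover have "f y = q p"
        using y openin_subset[OF W] by (auto simp: topspace_pullback_space)
      then have "p \<in> {p \<in> B. q p \<in> f ` A}" using AB by force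
      moreover have "{p \<in> B. q p \<in> f ` A} \<subseteq> snd ` W"
      proof
        fix p' assume "p' \<in> {p \<in> B. q p \<in> f ` A}"
        then obtain y' where "y' \<in> A" "p' \<in> B" "f y' = q p'" by auto
        then have "(y', p') \<in> W" using AB(5) by blast
        then show "p' \<in> snd ` W" by (rule image_eqI[rotated]) simp
      qed
      ultimately show "\<exists>V. openin P V \<and> p \<in> V \<and> V \<subseteq> snd ` W" by blast
    qed
  qed
  fix z assume z: "z \<in> topspace ?B"
  then have "fst z \<in> topspace Y" by (auto simp: topspace_pullback_space)
  with f obtain U where U: "openin Y U" "fst z \<in> U" "inj_on f U"
    unfolding local_homeomorphism_iff by blast
  let ?V = "{(y, p). y \<in> U \<and> p \<in> topspace P \<and> f y = q p}"
  have "openin ?B ?V" by (rule openin_pullback_space_box[OF U(1) openin_topspace])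
  moreover have "z \<in> ?V" using z U(2) by (auto simp: topspace_pullback_space)
  moreover have "inj_on snd ?V"
  proof (rule inj_onI)
    fix u v assume "u \<in> ?V" "v \<in> ?V" "snd u = snd v"
    moreover from this have "fst u = fst v" by (intro inj_onD[OF U(3)]) auto
    ultimately show "u = v" by (simp add: prod_eq_iff)
  qed
  ultimately show "\<exists>V. openin ?B V \<and> z \<in> V \<and> inj_on snd V" by blast
qed

text \<open>Only local injectivity has to descend. If two points near \<open>y\<close> have the same
  image \<open>q b\<close> with \<open>b\<close> near \<open>p\<close>, both pair with
  \<open>b\<close> to points of the pull-back with equal second component, and these
  coincide.\<close>

lemma local_homeomorphism_pullback_descent:
  assumes f: "continuous_map Y Z f" "open_map Y Z f"
    and q: "open_map P Z q" "q ` topspace P = topspace Z"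
    and snd: "local_homeomorphism (pullback_space Y f P q) P snd"
  shows "local_homeomorphism Y Z f"
  unfolding local_homeomorphism_iff
proof (intro conjI ballI f)
  fix y assume y: "y \<in> topspace Y"
  then have "f y \<in> topspace Z" using f(1) by (auto simp: continuous_map_def)
  then have "f y \<in> q ` topspace P" using q(2) by simp
  then obtain p where p: "p \<in> topspace P" "f y = q p" by (rule imageE)
  with y have "(y, p) \<in> topspace (pullback_space Y f P q)" by (simp add: topspace_pullback_space)
  then obtain U where U: "openin (pullback_space Y f P q) U" "(y, p) \<in> U" "inj_on snd U"
    using snd unfolding local_homeomorphism_iff by blast
  obtain A B where AB: "openin Y A" "openin P B" "y \<in> A" "p \<in> B"
    "\<forall>y' \<in> A. \<forall>p' \<in> B. f y' = q p' \<longrightarrow> (y', p') \<in> U"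
    by (rule openin_pullback_space_imp_box[OF U(1,2)])
  have "openin Z (q ` B)" using q(1) AB(2) by (simp add: open_map_def)
  then have "openin Y {y \<in> A. f y \<in> q ` B}"
    using openin_continuous_map_preimage_gen[OF f(1) AB(1)] by blast
  moreover have "y \<in> {y \<in> A. f y \<in> q ` B}" using AB p by auto
  moreover have "inj_on f {y \<in> A. f y \<in> q ` B}"
  proof (rule inj_onI)
    fix y1 y2 assume y1: "y1 \<in> {y \<in> A. f y \<in> q ` B}" and y2: "y2 \<in> {y \<in> A. f y \<in> q ` B}"
      and eq: "f y1 = f y2"
    then obtain b where "b \<in> B" "f y1 = q b" by auto
    then have "(y1, b) \<in> U" "(y2, b) \<in> U" using AB(5) y1 y2 eq by auto
    then show "y1 = y2" using inj_onD[OF U(3)] by fastforce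
  qed
  ultimately show "\<exists>U. openin Y U \<and> y \<in> U \<and> inj_on f U" by blast
qed

section \<open>Continuous actions and their orbit spaces\<close>

text \<open>The usual axioms suffice for a homomorphism into \<open>BijGroup\<close>, because
  \<open>a (inv g)\<close> is a two-sided inverse of \<open>a g\<close> on \<open>S\<close>.\<close>

lemma group_action_restrictI:
  fixes G (structure)
  assumes "group G"
    and closed: "\<And>g x. \<lbrakk>g \<in> carrier G; x \<in> S\<rbrakk> \<Longrightarrow> a g x \<in> S"
    and one: "\<And>x. x \<in> S \<Longrightarrow> a \<one> x = x"
    and mult: "\<And>g h x. \<lbrakk>g \<in> carrier G; h \<in> carrier G; x \<in> S\<rbrakk> \<Longrightarrow> a (g \<otimes> h) x = a g (a h x)"
  shows "group_action G S (\<lambda>g. restrict (a g) S)"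
proof -
  interpret group G by fact
  have bij: "restrict (a g) S \<in> Bij S" if g: "g \<in> carrier G" for g
  proof -
    have "bij_betw (a g) S S"
      using g closed mult[of "inv g" g] mult[of g "inv g"] one
      by (intro bij_betw_byWitness[of _ "a (inv g)"]) auto
    then show ?thesis
      by (simp add: Bij_def bij_betw_restrict_eq)
  qed
  have "restrict (a (g \<otimes> h)) S = compose S (restrict (a g) S) (restrict (a h) S)"
    if "g \<in> carrier G" "h \<in> carrier G" for g h
    using that closed mult by (auto simp: compose_def fun_eq_iff restrict_def)
  then have "(\<lambda>g. restrict (a g) S) \<in> hom G (BijGroup S)"
    using bij by (auto simp: hom_def BijGroup_def)
  then show ?thesis
    by (simp add: group_action_def group_hom_def group_hom_axioms_def group_BijGroup is_group)
qed

locale topological_action =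
  fixes G :: "('g, 'm) monoid_scheme" (structure)
    and T :: "'g topology" and X :: "'x topology" and a :: "'g \<Rightarrow> 'x \<Rightarrow> 'x"
  assumes lcg: "locally_compact_group G T" and act: "continuous_action G T X a"
begin

sublocale group G
  using lcg by (simp add: locally_compact_group_def)

sublocale ga: group_action G "topspace X" "\<lambda>g. restrict (a g) (topspace X)"
  using act by (simp add: continuous_action_def)

lemma topspace_T: "topspace T = carrier G"
  using lcg by (simp add: locally_compact_group_def)

lemma act_closed: "\<lbrakk>g \<in> carrier G; x \<in> topspace X\<rbrakk> \<Longrightarrow> a g x \<in> topspace X"
  using ga.element_image by fastforce

lemma act_one: "x \<in> topspace X \<Longrightarrow> a \<one> x = x"
  using fun_cong[OF ga.id_eq_one, of x] by simp

lemma act_mult: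
  "\<lbrakk>g \<in> carrier G; h \<in> carrier G; x \<in> topspace X\<rbrakk> \<Longrightarrow> a (g \<otimes> h) x = a g (a h x)"
  using ga.composition_rule[of x g h] by (simp add: act_closed)

lemma act_inv: "\<lbrakk>g \<in> carrier G; x \<in> topspace X\<rbrakk> \<Longrightarrow> a (inv g) (a g x) = x"
  using act_mult[of "inv g" g x] by (simp add: act_one)

lemma act_inv2: "\<lbrakk>g \<in> carrier G; x \<in> topspace X\<rbrakk> \<Longrightarrow> a g (a (inv g) x) = x"
  using act_inv[of "inv g" x] by simp

lemma continuous_action_map: "continuous_map (prod_topology T X) X (\<lambda>(g, x). a g x)"
  using act by (simp add: continuous_action_def)

lemma continuous_shear: "continuous_map (prod_topology T X) (prod_topology X X) (\<lambda>(g, x). (a g x, x))"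
  using continuous_map_pairedI[OF continuous_action_map continuous_map_snd]
  by (simp add: case_prod_unfold)

lemma continuous_act: "g \<in> carrier G \<Longrightarrow> continuous_map X X (a g)"
  using continuous_map_compose[OF continuous_map_pairedI continuous_action_map, of X "\<lambda>_. g" "\<lambda>x. x"]
  by (simp add: o_def topspace_T)

lemma homeomorphic_act:
  assumes "g \<in> carrier G"
  shows "homeomorphic_map X X (a g)"
  using assms continuous_act act_inv act_inv2
  by (auto simp: homeomorphic_map_maps homeomorphic_maps_def intro!: exI[of _ "a (inv g)"])

text \<open>The orbits are those of \<open>a\<close> itself, not of the restricted maps in
  \<open>ga\<close>. Right translation of the group parameter by \<open>g\<close> or
  \<open>inv g\<close> matches the two orbits.\<close>

lemma orbit_eq_iff:
  assumes "x \<in> topspace X" "y \<in> topspace X"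
  shows "orbit G a x = orbit G a y \<longleftrightarrow> (\<exists>g \<in> carrier G. x = a g y)"
proof
  have "x \<in> orbit G a x" using assms act_one by (force simp: orbit_def)
  then show "\<exists>g \<in> carrier G. x = a g y" if "orbit G a x = orbit G a y"
    using that by (auto simp: orbit_def)
next
  assume "\<exists>g \<in> carrier G. x = a g y"
  then obtain g where g: "g \<in> carrier G" "x = a g y" by blast
  have "a h x = a (h \<otimes> g) y" if "h \<in> carrier G" for h
    using g that assms by (simp add: act_mult)
  moreover have "a h y = a (h \<otimes> inv g) x" if "h \<in> carrier G" for h
    using g that assms by (simp add: act_mult act_inv)
  ultimately show "orbit G a x = orbit G a y"
    using g(1) unfolding orbit_def by (intro Collect_cong iffI) (blast intro: m_closed inv_closed)+
qed

lemma orbit_act: "\<lbrakk>g \<in> carrier G; x \<in> topspace X\<rbrakk> \<Longrightarrow> orbit G a (a g x) = orbit G a x"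
  by (subst orbit_eq_iff) (auto simp: act_closed)

section \<open>The topology of orbit spaces\<close>

lemma topspace_orbit_space: "topspace (orbit_space G X a) = orbit G a ` topspace X"
proof -
  have "{x \<in> topspace X. orbit G a x \<in> orbits G (topspace X) a} = topspace X"
    by (auto simp: orbits_def)
  then have "openin (orbit_space G X a) (orbits G (topspace X) a)"
    by (simp add: openin_orbit_space)
  then have "topspace (orbit_space G X a) = orbits G (topspace X) a"
    by (meson openin_orbit_space openin_subset openin_topspace subset_antisym)
  then show ?thesis by (auto simp: orbits_def)
qed

lemma quotient_map_orbit: "quotient_map X (orbit_space G X a) (orbit G a)"
  unfolding quotient_map_def
  by (auto simp: topspace_orbit_space openin_orbit_space orbits_def)

lemma continuous_orbit: "continuous_map X (orbit_space G X a) (orbit G a)"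
  by (rule quotient_imp_continuous_map[OF quotient_map_orbit])

text \<open>The saturation of an open set is the union of its translates, each of them open.\<close>

lemma open_map_orbit: "open_map X (orbit_space G X a) (orbit G a)"
  unfolding open_map_def
proof (intro allI impI)
  fix U assume U: "openin X U"
  then have sub: "U \<subseteq> topspace X" by (rule openin_subset)
  have "{x \<in> topspace X. orbit G a x \<in> orbit G a ` U} = (\<Union>g \<in> carrier G. a g ` U)"
  proof (intro subset_antisym subsetI)
    fix x assume "x \<in> {x \<in> topspace X. orbit G a x \<in> orbit G a ` U}"
    then obtain u where "x \<in> topspace X" "u \<in> U" "orbit G a x = orbit G a u" by blast
    then obtain g where "g \<in> carrier G" "x = a g u" using orbit_eq_iff sub by blast
    with \<open>u \<in> U\<close> show "x \<in> (\<Union>g \<in> carrier G. a g ` U)" by blast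
  next
    fix x assume "x \<in> (\<Union>g \<in> carrier G. a g ` U)"
    then show "x \<in> {x \<in> topspace X. orbit G a x \<in> orbit G a ` U}"
      using sub by (auto simp: act_closed orbit_act subset_iff)
  qed
  moreover have "openin X (a g ` U)" if "g \<in> carrier G" for g
    using homeomorphic_imp_open_map[OF homeomorphic_act[OF that]] U by (simp add: open_map_def)
  ultimately have "openin X {x \<in> topspace X. orbit G a x \<in> orbit G a ` U}"
    by auto
  then show "openin (orbit_space G X a) (orbit G a ` U)"
    using sub by (auto simp: openin_orbit_space orbits_def)
qed

lemma locally_compact_orbit_space:
  "locally_compact_space X \<Longrightarrow> locally_compact_space (orbit_space G X a)"
  using locally_compact_space_continuous_open_map_image[OF continuous_orbit open_map_orbit]
  by (simp add: topspace_orbit_space)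

text \<open>The orbit relation \<open>?R\<close> is the image of a proper map, hence closed. A box
  around \<open>(x, y)\<close> that misses it has sides lying in no common orbit, so their images
  under the open orbit map separate the two orbits.\<close>

lemma Hausdorff_orbit_space:
  assumes "proper_action T X a"
  shows "Hausdorff_space (orbit_space G X a)"
  unfolding Hausdorff_space_def
proof (intro allI impI, elim conjE)
  let ?Q = "orbit_space G X a" and ?R = "(\<lambda>(g, x). (a g x, x)) ` (topspace T \<times> topspace X)"
  fix u v assume uv: "u \<in> topspace ?Q" "v \<in> topspace ?Q" "u \<noteq> v"
  then obtain x y where xy: "x \<in> topspace X" "y \<in> topspace X" "u = orbit G a x" "v = orbit G a y"
    by (auto simp: topspace_orbit_space)
  have "closedin (prod_topology X X) ?R"
    using proper_imp_closed_map[OF assms[unfolded proper_action_def]]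
      closedin_topspace[of "prod_topology T X"]
    by (simp add: closed_map_def del: closedin_topspace)
  then have "openin (prod_topology X X) (topspace (prod_topology X X) - ?R)"
    by blast
  moreover have "(x, y) \<in> topspace (prod_topology X X) - ?R"
    using xy uv(3) orbit_eq_iff topspace_T by auto
  ultimately obtain A B where AB: "openin X A" "openin X B" "x \<in> A" "y \<in> B"
      "A \<times> B \<subseteq> topspace (prod_topology X X) - ?R"
    by (rule openin_prod_topology_imp_box)
  have "A \<subseteq> topspace X" "B \<subseteq> topspace X" by (intro openin_subset AB)+
  then have "disjnt (orbit G a ` A) (orbit G a ` B)"
    unfolding disjnt_iff
  proof (intro allI notI, elim conjE imageE)
    fix w x y assume w: "w = orbit G a x" "x \<in> A" "w = orbit G a y" "y \<in> B"
    then obtain g where "g \<in> carrier G" "x = a g y"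
      using orbit_eq_iff \<open>A \<subseteq> topspace X\<close> \<open>B \<subseteq> topspace X\<close> by blast
    then have "(x, y) \<in> ?R" using w \<open>B \<subseteq> topspace X\<close> topspace_T by auto
    then show False using AB(5) w by blast
  qed
  moreover have "openin ?Q (orbit G a ` A)" "openin ?Q (orbit G a ` B)"
    using open_map_orbit AB by (simp_all add: open_map_def)
  ultimately show "\<exists>U V. openin ?Q U \<and> openin ?Q V \<and> u \<in> U \<and> v \<in> V \<and> disjnt U V"
    using xy AB by blast
qed

text \<open>This replaces the continuity of the translation function \<open>(g x, x) \<mapsto> g\<close>.\<close>

lemma small_translation:
  assumes free: "free_action G X a" and proper: "proper_action T X a"
    and W: "openin T W" "\<one> \<in> W" and x: "x \<in> topspace X"
  obtains V where "openin X V" "x \<in> V"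
    "\<And>g v. \<lbrakk>g \<in> carrier G; v \<in> V; a g v \<in> V\<rbrakk> \<Longrightarrow> g \<in> W"
proof -
  let ?S = "\<lambda>(g, x). (a g x, x)"
  \<comment> \<open>\<open>?C\<close> collects the pairs related by a group element outside
    \<open>W\<close>. It is closed because a proper map is closed, and freeness keeps
    \<open>(x, x)\<close> out of it: only the unit, which lies in \<open>W\<close>, fixes
    \<open>x\<close>.\<close>
  let ?C = "?S ` ((topspace T - W) \<times> topspace X)"
  have "closedin (prod_topology T X) ((topspace T - W) \<times> topspace X)"
    using W(1) by (simp add: closedin_prod_Times_iff closedin_diff)
  then have "closedin (prod_topology X X) ?C"
    using proper proper_imp_closed_map unfolding proper_action_def closed_map_def by blast
  then have "openin (prod_topology X X) (topspace (prod_topology X X) - ?C)" by blast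
  moreover have "(x, x) \<in> topspace (prod_topology X X) - ?C"
    using x free W topspace_T unfolding free_action_def by fastforce
  ultimately obtain A B where AB: "openin X A" "openin X B" "x \<in> A" "x \<in> B"
      "A \<times> B \<subseteq> topspace (prod_topology X X) - ?C"
    by (rule openin_prod_topology_imp_box)
  show thesis
  proof
    show "openin X (A \<inter> B)" "x \<in> A \<inter> B" using AB by auto
    fix g v assume g: "g \<in> carrier G" "v \<in> A \<inter> B" "a g v \<in> A \<inter> B"
    then have "(a g v, v) \<notin> ?C" using AB(5) by blast
    moreover have "v \<in> topspace X" using g AB openin_subset by blast
    ultimately show "g \<in> W" using g(1) topspace_T by force
  qed
qed

lemma principal_bundle_orbit_space:
  assumes "locally_compact_space X" "Hausdorff_space X" "free_action G X a" "proper_action T X a"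
  shows "principal_bundle G T X a (orbit_space G X a) (orbit G a)"
  unfolding principal_bundle_def
  using assms act locally_compact_orbit_space Hausdorff_orbit_space
  by (auto intro!: exI[of _ id])

end

section \<open>Equivariant maps\<close>

locale equivariant_map =
  X: topological_action G T X a + Y: topological_action G T Y b
  for G :: "('g, 'm) monoid_scheme" (structure) and T :: "'g topology"
    and X :: "'x topology" and a and Y :: "'y topology" and b +
  fixes f :: "'x \<Rightarrow> 'y"
  assumes cont: "continuous_map X Y f"
    and equivariant: "\<lbrakk>g \<in> carrier G; x \<in> topspace X\<rbrakk> \<Longrightarrow> f (a g x) = b g (f x)"
begin

lemma map_closed: "x \<in> topspace X \<Longrightarrow> f x \<in> topspace Y"
  using cont by (auto simp: continuous_map_def)

text \<open>Hence the direct image \<open>(`) f\<close> is the map of orbit spaces induced by \<open>f\<close>.\<close>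

lemma image_orbit: "x \<in> topspace X \<Longrightarrow> f ` orbit G a x = orbit G b (f x)"
  by (auto simp: orbit_def equivariant) (use equivariant in force)

lemma continuous_map_orbit_space:
  "continuous_map (orbit_space G X a) (orbit_space G Y b) ((`) f)"
  using continuous_map_compose[OF cont Y.continuous_orbit] image_orbit
  by (subst continuous_compose_quotient_map_eq[OF X.quotient_map_orbit, symmetric])
    (auto elim: continuous_map_eq)

text \<open>An open set of orbits is the image of its preimage \<open>?V\<close> in
  \<open>X\<close>, so its direct image is obtained from \<open>?V\<close> by applying the two open
  maps \<open>f\<close> and \<open>orbit G b\<close>.\<close>

lemma open_map_orbit_space:
  assumes "open_map X Y f"
  shows "open_map (orbit_space G X a) (orbit_space G Y b) ((`) f)"
  unfolding open_map_def
proof (intro allI impI)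
  fix U assume U: "openin (orbit_space G X a) U"
  let ?V = "{x \<in> topspace X. orbit G a x \<in> U}"
  have "openin X ?V" using U by (simp add: openin_orbit_space)
  then have "openin (orbit_space G Y b) (orbit G b ` f ` ?V)"
    using assms Y.open_map_orbit by (simp add: open_map_def)
  moreover have "U = orbit G a ` ?V"
    using openin_subset[OF U] by (auto simp: X.topspace_orbit_space)
  then have "(`) f ` U = orbit G b ` f ` ?V"
    by (smt (verit, best) image_cong image_image image_orbit mem_Collect_eq)
  ultimately show "openin (orbit_space G Y b) ((`) f ` U)" by simp
qed

text \<open>Surjectivity comes from moving \<open>x\<close> along its orbit until \<open>f x\<close>
  reaches the prescribed point, injectivity from freeness on \<open>Y\<close>. Openness amounts to
  continuity of the inverse and rests on \<open>small_translation\<close> in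
  \<open>Y\<close>.\<close>

lemma homeomorphic_map_pullback_space:
  assumes free: "free_action G Y b" and proper: "proper_action T Y b"
  shows "homeomorphic_map X (pullback_space (orbit_space G X a) ((`) f) Y (orbit G b))
    (\<lambda>x. (orbit G a x, f x))"
proof (rule bijective_open_imp_homeomorphic_map)
  let ?B = "pullback_space (orbit_space G X a) ((`) f) Y (orbit G b)"
    and ?\<phi> = "\<lambda>x. (orbit G a x, f x)"
  show "continuous_map X ?B ?\<phi>"
    by (intro continuous_map_into_pullback_space X.continuous_orbit cont image_orbit)
  show "?\<phi> ` topspace X = topspace ?B"
  proof (intro subset_antisym subsetI)
    fix z assume "z \<in> topspace ?B"
    then obtain x y where xy: "x \<in> topspace X" "y \<in> topspace Y" "z = (orbit G a x, y)"
      "orbit G b y = orbit G b (f x)"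
      by (auto simp: topspace_pullback_space X.topspace_orbit_space image_orbit)
    then obtain g where "g \<in> carrier G" "y = b g (f x)"
      using Y.orbit_eq_iff map_closed by blast
    then have "z = ?\<phi> (a g x)" "a g x \<in> topspace X"
      using xy by (auto simp: equivariant X.orbit_act X.act_closed)
    then show "z \<in> ?\<phi> ` topspace X" by blast
  qed (auto simp: topspace_pullback_space X.topspace_orbit_space image_orbit[symmetric] map_closed)
  show "inj_on ?\<phi> (topspace X)"
  proof (rule inj_onI)
    fix x x' assume x: "x \<in> topspace X" "x' \<in> topspace X" "?\<phi> x = ?\<phi> x'"
    then obtain g where g: "g \<in> carrier G" "x = a g x'"
      using X.orbit_eq_iff by auto
    then have "b g (f x') = f x'" using x equivariant by force
    then have "g = \<one>" using free g x map_closed unfolding free_action_def by blast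
    then show "x = x'" using g x by (simp add: X.act_one)
  qed
  show "open_map X ?B ?\<phi>"
    unfolding open_map_def
  proof (intro allI impI)
    fix U assume U: "openin X U"
    show "openin ?B (?\<phi> ` U)"
    proof (subst openin_subopen, intro ballI)
      fix z assume "z \<in> ?\<phi> ` U"
      then obtain x where x: "x \<in> U" "z = ?\<phi> x" by blast
      then have xX: "x \<in> topspace X" using U openin_subset by blast
      \<comment> \<open>Continuity of the action at \<open>(\<one>, x)\<close> yields
        \<open>W\<close> and \<open>V\<close> such that elements of \<open>W\<close> move
        \<open>V\<close> into \<open>U\<close>.\<close>
      have "openin (prod_topology T X) {z \<in> topspace (prod_topology T X). (\<lambda>(g, x). a g x) z \<in> U}"
        by (rule openin_continuous_map_preimage[OF X.continuous_action_map U])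
      moreover have "(\<one>, x) \<in> {z \<in> topspace (prod_topology T X). (\<lambda>(g, x). a g x) z \<in> U}"
        using x xX by (simp add: X.act_one X.topspace_T)
      ultimately obtain W V where WV: "openin T W" "openin X V" "\<one> \<in> W" "x \<in> V"
        "W \<times> V \<subseteq> {z \<in> topspace (prod_topology T X). (\<lambda>(g, x). a g x) z \<in> U}"
        by (rule openin_prod_topology_imp_box)
      obtain N where N: "openin Y N" "f x \<in> N"
        "\<And>g v. \<lbrakk>g \<in> carrier G; v \<in> N; b g v \<in> N\<rbrakk> \<Longrightarrow> g \<in> W"
        using Y.small_translation[OF free proper WV(1,3) map_closed[OF xX]] by blast
      \<comment> \<open>A point of \<open>?O\<close> is \<open>(orbit G a v, y)\<close> with
        \<open>y = b g (f v)\<close>. As \<open>f v\<close> and \<open>y\<close> both lie in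
        \<open>N\<close>, the choice of \<open>N\<close> forces \<open>g\<close> into
        \<open>W\<close>; hence \<open>a g v\<close> lies in \<open>U\<close>, and it is the
        required preimage.\<close>
      let ?V = "{v \<in> V. f v \<in> N}"
      let ?O = "{(u, y). u \<in> orbit G a ` ?V \<and> y \<in> N \<and> f ` u = orbit G b y}"
      have "openin X ?V"
        by (rule openin_continuous_map_preimage_gen[OF cont WV(2) N(1)])
      then have "openin ?B ?O"
        using X.open_map_orbit N(1) by (intro openin_pullback_space_box) (auto simp: open_map_def)
      moreover have "z \<in> ?O" using x WV N image_orbit[OF xX] by auto
      moreover have "?O \<subseteq> ?\<phi> ` U"
      proof
        fix w assume "w \<in> ?O"
        then obtain v y where w: "w = (orbit G a v, y)" "v \<in> V" "f v \<in> N" "y \<in> N"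
          "f ` orbit G a v = orbit G b y" by auto
        then have v: "v \<in> topspace X" "y \<in> topspace Y"
          using WV N openin_subset by blast+
        then obtain g where g: "g \<in> carrier G" "y = b g (f v)"
          using w(5) image_orbit Y.orbit_eq_iff map_closed by metis
        then have "g \<in> W" using N(3) w by blast
        then have "a g v \<in> U" using subsetD[OF WV(5), of "(g, v)"] w(2) by simp
        moreover have "w = ?\<phi> (a g v)"
          using w g v by (simp add: equivariant X.orbit_act)
        ultimately show "w \<in> ?\<phi> ` U" by blast
      qed
      ultimately show "\<exists>V. openin ?B V \<and> z \<in> V \<and> V \<subseteq> ?\<phi> ` U" by blast
    qed
  qed
qed

text \<open>If \<open>(a g x, x)\<close> lies in a compact \<open>K\<close>, then
  \<open>(b g (f x), f x)\<close> lies in its compact image, so properness on \<open>Y\<close>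
  confines \<open>g\<close> to a compact set, while \<open>x\<close> stays in the second projection
  of \<open>K\<close>. Local compactness and the Hausdorff property of \<open>X\<close> supply the
  \<open>k_space\<close> and \<open>kc_space\<close> conditions of the criterion.\<close>

lemma proper_action_pullback:
  assumes X: "locally_compact_space X" "Hausdorff_space X" and Y: "proper_action T Y b"
  shows "proper_action T X a"
  unfolding proper_action_def
proof (rule compact_imp_proper_map)
  let ?S = "\<lambda>(g, x). (a g x, x)"
  let ?f = "\<lambda>(x, x'). (f x, f x')"
  show "k_space (prod_topology X X)"
    using X by (simp add: locally_compact_imp_k_space locally_compact_space_prod_topology)
  show "kc_space (prod_topology X X)"
    using X by (simp add: Hausdorff_imp_kc_space Hausdorff_space_prod_topology)
  show "?S \<in> topspace (prod_topology T X) \<rightarrow> topspace (prod_topology X X)"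
    by (auto simp: X.topspace_T X.act_closed)
  show "continuous_map (prod_topology T X) (prod_topology X X) ?S \<or> kc_space (prod_topology T X)"
    using X.continuous_shear by blast
  fix K assume K: "compactin (prod_topology X X) K"
  let ?A = "{z \<in> topspace (prod_topology T X). ?S z \<in> K}"
  \<comment> \<open>The first projection of \<open>?L\<close> is the compact set that confines the
    group component.\<close>
  let ?L = "{z \<in> topspace (prod_topology T Y). (\<lambda>(g, y). (b g y, y)) z \<in> ?f ` K}"
  have "closedin (prod_topology X X) K"
    using K X by (simp add: compactin_imp_closedin Hausdorff_space_prod_topology)
  then have closed: "closedin (prod_topology T X) ?A"
    by (rule closedin_continuous_map_preimage[OF X.continuous_shear])
  have "continuous_map (prod_topology X X) (prod_topology Y Y) ?f"
    by (simp add: continuous_map_prod_top cont)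
  then have "compactin (prod_topology Y Y) (?f ` K)"
    by (rule image_compactin[OF K])
  then have "compactin (prod_topology T Y) ?L"
    using Y compactin_proper_map_preimage unfolding proper_action_def by blast
  then have "compactin T (fst ` ?L)" by (rule image_compactin) (rule continuous_map_fst)
  moreover have "compactin X (snd ` K)" by (rule image_compactin[OF K continuous_map_snd])
  ultimately have "compactin (prod_topology T X) (fst ` ?L \<times> snd ` K)"
    by (simp add: compactin_Times)
  moreover have "?A \<subseteq> fst ` ?L \<times> snd ` K"
  proof
    fix z assume "z \<in> ?A"
    then obtain g x where z: "z = (g, x)" "g \<in> carrier G" "x \<in> topspace X" "(a g x, x) \<in> K"
      by (auto simp: X.topspace_T)
    then have "(b g (f x), f x) \<in> ?f ` K"
      by (force simp: equivariant[symmetric])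
    then have "(g, f x) \<in> ?L" using z by (simp add: X.topspace_T map_closed)
    then have "g \<in> fst ` ?L" by force
    moreover have "x \<in> snd ` K" using z(4) by force
    ultimately show "z \<in> fst ` ?L \<times> snd ` K" using z(1) by blast
  qed
  ultimately show "compactin (prod_topology T X) ?A"
    using closed by (meson closed_compactin)
qed

end

section \<open>Graphs from principal bundles\<close>

lemma bundle_graph_properties:
  fixes G :: "('g, 'm) monoid_scheme" (structure)
  assumes lcg: "locally_compact_group G T" and data: "bundle_data G T F P a q \<theta>"
  defines "E \<equiv> bundle_graph F P q \<theta>"
  shows "topological_graph E" "tgraph_action G T E a (pullback_act a)"
    "free_tgraph_action G E a" "proper_tgraph_action T E a (pullback_act a)"
proof -
  let ?S = "pullback_space (edges F) (src F) P q" and ?R = "pullback_space (edges F) (rng F) P q"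
  note E = E_def bundle_graph_def
  have F: "locally_compact_space (verts F)" "Hausdorff_space (verts F)"
    "locally_compact_space (edges F)" "Hausdorff_space (edges F)"
    "local_homeomorphism (edges F) (verts F) (src F)"
    using data by (auto simp: bundle_data_def topological_graph_def)
  have P: "locally_compact_space P" "Hausdorff_space P" "continuous_action G T P a"
    "free_action G P a" "proper_action T P a"
    using data by (auto simp: bundle_data_def principal_bundle_def)
  have \<theta>: "homeomorphic_map ?S ?R \<theta>"
    "\<And>g p. \<lbrakk>g \<in> carrier G; p \<in> topspace ?S\<rbrakk> \<Longrightarrow> \<theta> (pullback_act a g p) = pullback_act a g (\<theta> p)"
    using data by (auto simp: bundle_data_def bundle_iso_def)
  interpret P: topological_action G T P a
    by (rule topological_action.intro[OF lcg P(3)])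
  obtain h where h: "homeomorphic_map (orbit_space G P a) (verts F) h"
      "\<And>p. p \<in> topspace P \<Longrightarrow> h (orbit G a p) = q p"
    using data by (auto simp: bundle_data_def principal_bundle_def)
  have q: "continuous_map P (verts F) q"
    using continuous_map_compose[OF P.continuous_orbit homeomorphic_imp_continuous_map[OF h(1)]] h(2)
    by (auto elim: continuous_map_eq)
  \<comment> \<open>Invariance of \<open>q\<close> is what makes \<open>pullback_act a\<close>
    preserve the fibre product.\<close>
  have q_act: "q (a g p) = q p" if "g \<in> carrier G" "p \<in> topspace P" for g p
    using that h(2) P.act_closed P.orbit_act by metis
  have src: "continuous_map (edges F) (verts F) (src F)"
    using F(5) by (simp add: local_homeomorphism_def)
  have "group_action G (topspace ?S) (\<lambda>g. restrict (pullback_act a g) (topspace ?S))"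
    by (rule group_action_restrictI)
      (auto simp: pullback_act_def topspace_pullback_space P.act_closed P.act_one P.act_mult q_act
        P.is_group)
  moreover have "continuous_map (prod_topology T ?S) ?S (\<lambda>(g, z). pullback_act a g z)"
  proof -
    have "continuous_map (prod_topology T ?S) P (\<lambda>z. (\<lambda>(g, x). a g x) (fst z, snd (snd z)))"
      using continuous_map_compose[OF continuous_map_snd continuous_map_pullback_snd]
      by (intro continuous_map_compose[OF continuous_map_pairedI P.continuous_action_map,
          unfolded o_def] continuous_map_fst) (simp add: o_def)
    moreover have "continuous_map (prod_topology T ?S) (edges F) (\<lambda>z. fst (snd z))"
      using continuous_map_compose[OF continuous_map_snd continuous_map_pullback_fst]
      by (simp add: o_def)
    ultimately have "continuous_map (prod_topology T ?S) ?S
        (\<lambda>z. (fst (snd z), (\<lambda>(g, x). a g x) (fst z, snd (snd z))))"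
      by (intro continuous_map_into_pullback_space)
        (auto simp: topspace_pullback_space P.topspace_T q_act)
    then show ?thesis
      by (simp add: pullback_act_def case_prod_unfold)
  qed
  ultimately have S: "continuous_action G T ?S (pullback_act a)"
    by (simp add: continuous_action_def)
  \<comment> \<open>Equivariance of the projection to \<open>P\<close> is what transfers properness
    to the edges below.\<close>
  interpret S: equivariant_map G T ?S "pullback_act a" P a snd
    by (intro equivariant_map.intro topological_action.intro equivariant_map_axioms.intro lcg S P
        continuous_map_pullback_snd) (auto simp: pullback_act_def)
  have lcS: "locally_compact_space ?S" "Hausdorff_space ?S"
    by (intro locally_compact_space_pullback_space[OF src q] Hausdorff_space_pullback_space[OF src q] F P)+
  show "topological_graph E"
    unfolding topological_graph_def E
    using lcS P local_homeomorphism_pullback_snd[OF F(5) q]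
      continuous_map_compose[OF homeomorphic_imp_continuous_map[OF \<theta>(1)] continuous_map_pullback_snd]
    by simp
  \<comment> \<open>Compatibility with the range map \<open>snd \<circ> \<theta>\<close> is the
    equivariance of \<open>\<theta>\<close>; for the source map \<open>snd\<close> it is
    immediate.\<close>
  show "tgraph_action G T E a (pullback_act a)"
    unfolding tgraph_action_def tgraph_iso_def E
    using S P.act P.homeomorphic_act S.X.homeomorphic_act \<theta>(2)
    by (auto simp: pullback_act_def split_beta)
  show "free_tgraph_action G E a"
    using P(4) by (simp add: free_tgraph_action_def E)
  show "proper_tgraph_action T E a (pullback_act a)"
    using P(5) S.proper_action_pullback[OF lcS P(5)] by (simp add: proper_tgraph_action_def E)
qed

text \<open>The total space of the bundle is the vertex space of \<open>E\<close> itself, so the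
  isomorphism is the identity on vertices. \<open>F\<close> and both maps are given explicitly so
  that equivariance, which \<open>tgraph_iso\<close> does not contain, can be checked
  afterwards.\<close>

lemma tgraph_iso_bundle_graph:
  fixes G :: "('g, 'm) monoid_scheme" (structure) and E :: "('x, 'y) tgraph"
  assumes lcg: "locally_compact_group G T" and E: "topological_graph E"
    and act: "tgraph_action G T E a0 a1"
    and free: "free_tgraph_action G E a0" and proper: "proper_tgraph_action T E a0 a1"
  defines "F \<equiv> \<lparr>verts = orbit_space G (verts E) a0, edges = orbit_space G (edges E) a1,
      src = (`) (src E), rng = (`) (rng E)\<rparr>"
  obtains \<theta> where "bundle_data G T F (verts E) a0 (orbit G a0) \<theta>"
    "tgraph_iso E (bundle_graph F (verts E) (orbit G a0) \<theta>) id (\<lambda>e. (orbit G a1 e, src E e))"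
proof -
  let ?P = "verts E" and ?q = "orbit G a0"
  let ?S = "pullback_space (edges F) (src F) ?P ?q" and ?R = "pullback_space (edges F) (rng F) ?P ?q"
  let ?\<phi> = "\<lambda>e. (orbit G a1 e, src E e)" and ?\<psi> = "\<lambda>e. (orbit G a1 e, rng E e)"
  have lcH: "locally_compact_space (verts E)" "Hausdorff_space (verts E)"
    "locally_compact_space (edges E)" "Hausdorff_space (edges E)"
    and src: "continuous_map (edges E) (verts E) (src E)" "open_map (edges E) (verts E) (src E)"
    and src_lh: "local_homeomorphism (edges E) (verts E) (src E)"
    and rng: "continuous_map (edges E) (verts E) (rng E)"
    using E by (auto simp: topological_graph_def local_homeomorphism_iff)
  have free0: "free_action G (verts E) a0" and proper0: "proper_action T (verts E) a0"
    and proper1: "proper_action T (edges E) a1"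
    using free proper by (auto simp: free_tgraph_action_def proper_tgraph_action_def)
  interpret V: topological_action G T "verts E" a0
    using lcg act by unfold_locales (auto simp: tgraph_action_def)
  interpret D: topological_action G T "edges E" a1
    using lcg act by unfold_locales (auto simp: tgraph_action_def)
  interpret s: equivariant_map G T "edges E" a1 "verts E" a0 "src E"
    using src act by unfold_locales (auto simp: tgraph_action_def tgraph_iso_def)
  interpret r: equivariant_map G T "edges E" a1 "verts E" a0 "rng E"
    using rng act by unfold_locales (auto simp: tgraph_action_def tgraph_iso_def)
  \<comment> \<open>In both cases the target of the equivariant map is the vertex space, where the
    action is free by assumption.\<close>
  have \<phi>: "homeomorphic_map (edges E) ?S ?\<phi>" and \<psi>: "homeomorphic_map (edges E) ?R ?\<psi>"
    using s.homeomorphic_map_pullback_space r.homeomorphic_map_pullback_space free0 proper0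
    by (simp_all add: F_def)
  obtain \<phi>' where "homeomorphic_maps (edges E) ?S ?\<phi> \<phi>'"
    using \<phi> by (auto simp: homeomorphic_map_maps)
  then have \<phi>': "homeomorphic_map ?S (edges E) \<phi>'"
    "\<And>e. e \<in> topspace (edges E) \<Longrightarrow> \<phi>' (?\<phi> e) = e"
    by (simp_all add: homeomorphic_maps_map)
  have S: "topspace ?S = ?\<phi> ` topspace (edges E)"
    using homeomorphic_imp_surjective_map[OF \<phi>] by simp
  \<comment> \<open>On \<open>?S\<close> the projection equals \<open>src E \<circ> \<phi>'\<close>.
    Descent along the open surjection \<open>?q\<close> then makes the source map of
    \<open>F\<close> a local homeomorphism, its openness being inherited from
    \<open>src E\<close>.\<close>
  have "local_homeomorphism ?S ?P snd"
    using S \<phi>'(2) by (intro local_homeomorphism_compose_homeomorphic_map[OF \<phi>'(1) src_lh]) auto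
  then have F: "topological_graph F"
    using s.continuous_map_orbit_space r.continuous_map_orbit_space
      s.open_map_orbit_space[OF src(2)] V.open_map_orbit lcH proper0 proper1
      local_homeomorphism_pullback_descent[of "edges F" "verts F" "src F" ?P ?q]
      V.locally_compact_orbit_space D.locally_compact_orbit_space
      V.Hausdorff_orbit_space D.Hausdorff_orbit_space
    by (simp add: topological_graph_def F_def V.topspace_orbit_space)
  \<comment> \<open>This map sends \<open>(orbit G a1 e, src E e)\<close> to
    \<open>(orbit G a1 e, rng E e)\<close>. It is equivariant because \<open>?\<phi>\<close> and
    \<open>?\<psi>\<close> both intertwine \<open>a1\<close> with
    \<open>pullback_act a0\<close>.\<close>
  have \<theta>: "bundle_iso G ?S (pullback_act a0) fst ?R (pullback_act a0) fst (?\<psi> \<circ> \<phi>')"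
    unfolding bundle_iso_def
  proof (intro conjI ballI)
    show "homeomorphic_map ?S ?R (?\<psi> \<circ> \<phi>')"
      by (rule homeomorphic_map_compose[OF \<phi>'(1) \<psi>])
    fix z assume "z \<in> topspace ?S"
    then obtain e where e: "e \<in> topspace (edges E)" "z = ?\<phi> e" using S by blast
    then show "fst ((?\<psi> \<circ> \<phi>') z) = fst z" using \<phi>'(2) by simp
    fix g assume g: "g \<in> carrier G"
    have "pullback_act a0 g (?\<phi> e) = ?\<phi> (a1 g e)" "pullback_act a0 g (?\<psi> e) = ?\<psi> (a1 g e)"
      using e g by (simp_all add: pullback_act_def D.orbit_act s.equivariant r.equivariant)
    then show "(?\<psi> \<circ> \<phi>') (pullback_act a0 g z) = pullback_act a0 g ((?\<psi> \<circ> \<phi>') z)"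
      using e g \<phi>'(2) D.act_closed by simp
  qed
  show thesis
  proof
    show "bundle_data G T F ?P a0 ?q (?\<psi> \<circ> \<phi>')"
      using F \<theta> V.principal_bundle_orbit_space[OF lcH(1,2) free0 proper0]
      by (simp add: bundle_data_def F_def)
    \<comment> \<open>The range map of the bundle graph takes \<open>?\<phi> e\<close> to the second
      component of \<open>?\<psi> e\<close>, which is \<open>rng E e\<close>.\<close>
    show "tgraph_iso E (bundle_graph F ?P ?q (?\<psi> \<circ> \<phi>')) id ?\<phi>"
      using \<phi> \<phi>'(2) by (simp add: tgraph_iso_def bundle_graph_def)
  qed
qed

text \<open>In the converse the types of \<open>F\<close> are set types because its vertices and
  edges are orbits. Equivariance of the isomorphism ensures that the given action, and not only the
  graph, is recovered.\<close>

theorem theorem3p4: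
  fixes G :: "('g, 'm) monoid_scheme" and T :: "'g topology"
  assumes "locally_compact_group G T"
  shows
    "(\<forall>(F :: ('v, 'e) tgraph) (P :: 'p topology) a q \<theta>.
        bundle_data G T F P a q \<theta> \<longrightarrow>
        topological_graph (bundle_graph F P q \<theta>) \<and>
        tgraph_action G T (bundle_graph F P q \<theta>) a (pullback_act a) \<and>
        free_tgraph_action G (bundle_graph F P q \<theta>) a \<and>
        proper_tgraph_action T (bundle_graph F P q \<theta>) a (pullback_act a))
     \<and>
     (\<forall>(E :: ('x, 'y) tgraph) a0 a1.
        topological_graph E \<and> tgraph_action G T E a0 a1 \<and>
        free_tgraph_action G E a0 \<and> proper_tgraph_action T E a0 a1 \<longrightarrow>
        (\<exists>(F :: ('x set, 'y set) tgraph) (P :: 'x topology) a q \<theta> \<phi>0 \<phi>1.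
           bundle_data G T F P a q \<theta> \<and>
           tgraph_iso E (bundle_graph F P q \<theta>) \<phi>0 \<phi>1 \<and>
           (\<forall>g \<in> carrier G.
              (\<forall>v \<in> topspace (verts E). \<phi>0 (a0 g v) = a g (\<phi>0 v)) \<and>
              (\<forall>e \<in> topspace (edges E). \<phi>1 (a1 g e) = pullback_act a g (\<phi>1 e)))))"
proof (intro conjI allI impI; (elim conjE)?)
  fix F :: "('v, 'e) tgraph" and P :: "'p topology" and a q \<theta>
  assume "bundle_data G T F P a q \<theta>"
  note * = bundle_graph_properties[OF assms this]
  show "topological_graph (bundle_graph F P q \<theta>)"
    "tgraph_action G T (bundle_graph F P q \<theta>) a (pullback_act a)"
    "free_tgraph_action G (bundle_graph F P q \<theta>) a"
    "proper_tgraph_action T (bundle_graph F P q \<theta>) a (pullback_act a)"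
    by (fact *)+
next
  fix E :: "('x, 'y) tgraph" and a0 a1
  let ?F = "\<lparr>verts = orbit_space G (verts E) a0, edges = orbit_space G (edges E) a1,
      src = (`) (src E), rng = (`) (rng E)\<rparr>"
  assume E: "topological_graph E" "tgraph_action G T E a0 a1"
    "free_tgraph_action G E a0" "proper_tgraph_action T E a0 a1"
  obtain \<theta> where \<theta>: "bundle_data G T ?F (verts E) a0 (orbit G a0) \<theta>"
    "tgraph_iso E (bundle_graph ?F (verts E) (orbit G a0) \<theta>) id
      (\<lambda>e. (orbit G a1 e, src E e))"
    by (rule tgraph_iso_bundle_graph[OF assms E])
  interpret D: topological_action G T "edges E" a1
    using assms E(2) by unfold_locales (auto simp: tgraph_action_def)
  \<comment> \<open>Only the edge map needs an argument for equivariance, the vertex map being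
    \<open>id\<close> and the action on the total space being \<open>a0\<close>.\<close>
  have "(orbit G a1 (a1 g e), src E (a1 g e)) = pullback_act a0 g (orbit G a1 e, src E e)"
    if "g \<in> carrier G" "e \<in> topspace (edges E)" for g e
    using that E(2) by (simp add: pullback_act_def D.orbit_act tgraph_action_def tgraph_iso_def)
  with \<theta> show "\<exists>(F :: ('x set, 'y set) tgraph) (P :: 'x topology) a q \<theta> \<phi>0 \<phi>1.
           bundle_data G T F P a q \<theta> \<and>
           tgraph_iso E (bundle_graph F P q \<theta>) \<phi>0 \<phi>1 \<and>
           (\<forall>g \<in> carrier G.
              (\<forall>v \<in> topspace (verts E). \<phi>0 (a0 g v) = a g (\<phi>0 v)) \<and>
              (\<forall>e \<in> topspace (edges E). \<phi>1 (a1 g e) = pullback_act a g (\<phi>1 e)))"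
    by (intro exI conjI) auto
qed

end
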